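(* Let $(x,y,z)$ be the three non-identity elements of $\mathbb Z_2\times\mathbb Z_2$ in some order. If $w$ is a non-constant finite word in $x,y,z$ and $$|w|_x\equiv|w|_y\not\equiv|w|_z\equiv|w|\pmod 2,$$ then $w$ is valid for some finite binary tree $T$.
   Context: $|w|$ is the length of $w$ and $|w|_x$ is the number of occurrences of $x$ in $w$ (similarly for $y$, $z$). A word $w$ of length $n$ is regarded as a color vector $(c_1,\dots,c_n)$ with entries in $\mathbb Z_2\times\mathbb Z_2$. Finite binary trees are rooted, planar; every vertex has $0$ or two (ordered) children except the root, which has degree $1$ and a single child. Leaves are numbered left to right. A color vector for a tree with $n$ leaves determines the unique edge coloring in which the edge at the $i$-th leaf has color $c_i$ and the three edges at each vertex of degree $3$ sum to $0$ in $\mathbb Z_2\times\mathbb Z_2$. It is valid for the tree if this is a proper edge coloring using only non-zero colors. *)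

theory Defs
  imports "HOL-Library.Z2" "HOL-Library.Product_Plus" "HOL-Number_Theory.Cong"
begin

text \<open>The additive group on \<^typ>\<open>bit \<times> bit\<close> is the componentwise one.\<close>

type_synonym color = "bit \<times> bit"

text \<open>
  A \<^emph>\<open>branch\<close> is the part of a tree hanging from an edge: its topmost vertex has no child or an
  ordered pair of children. A finite binary tree is a root with a single branch below it. The
  smallest one, \<open>Root Leaf\<close>, is a single edge, and its root does not count as a leaf.
\<close>

datatype branch = Leaf | Fork branch branch

datatype bintree = Root branch

text \<open>
  A vertex is named by its path from the root: the root is \<open>[]\<close>, its only child is \<open>[0]\<close>,
  and the left and right children of a vertex \<open>v\<close> are \<open>v @ [0]\<close> and \<open>v @ [1]\<close>.
\<close>

type_synonym vertex = "nat list"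

fun branch_vertices :: "branch \<Rightarrow> vertex set" where
  "branch_vertices Leaf = {[]}"
| "branch_vertices (Fork l r) =
     insert [] ((#) 0 ` branch_vertices l \<union> (#) 1 ` branch_vertices r)"

fun vertices :: "bintree \<Rightarrow> vertex set" where
  "vertices (Root b) = insert [] ((#) 0 ` branch_vertices b)"

fun branch_leaves :: "branch \<Rightarrow> vertex list" where
  "branch_leaves Leaf = [[]]"
| "branch_leaves (Fork l r) = map ((#) 0) (branch_leaves l) @ map ((#) 1) (branch_leaves r)"

fun leaves :: "bintree \<Rightarrow> vertex list" where
  "leaves (Root b) = map ((#) 0) (branch_leaves b)"

text \<open>The edge joining a non-root vertex to its parent.\<close>

definition edge :: "vertex \<Rightarrow> vertex set" where
  "edge v = {butlast v, v}"

definition edges :: "bintree \<Rightarrow> vertex set set" where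
  "edges T = edge ` (vertices T - {[]})"

definition incident :: "bintree \<Rightarrow> vertex \<Rightarrow> vertex set set" where
  "incident T v = {e \<in> edges T. v \<in> e}"

definition degree :: "bintree \<Rightarrow> vertex \<Rightarrow> nat" where
  "degree T v = card (incident T v)"

text \<open>
  The edge coloring \<open>f\<close> is the one determined by the color vector \<open>c\<close>; only the values of \<open>f\<close>
  on edges matter. Existence and uniqueness are shown in \<open>coloring_exists\<close> and
  \<open>coloring_unique\<close> below.
\<close>

definition determined_coloring :: "bintree \<Rightarrow> color list \<Rightarrow> (vertex set \<Rightarrow> color) \<Rightarrow> bool" where
  "determined_coloring T c f \<longleftrightarrow>
     (\<forall>i < length (leaves T). f (edge (leaves T ! i)) = c ! i) \<and>
     (\<forall>v \<in> vertices T. degree T v = 3 \<longrightarrow> (\<Sum>e \<in> incident T v. f e) = 0)"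

definition proper_coloring :: "bintree \<Rightarrow> (vertex set \<Rightarrow> color) \<Rightarrow> bool" where
  "proper_coloring T f \<longleftrightarrow>
     (\<forall>e \<in> edges T. \<forall>e' \<in> edges T. e \<noteq> e' \<and> e \<inter> e' \<noteq> {} \<longrightarrow> f e \<noteq> f e')"

definition valid :: "color list \<Rightarrow> bintree \<Rightarrow> bool" where
  "valid c T \<longleftrightarrow> length c = length (leaves T) \<and>
     (\<exists>f. determined_coloring T c f \<and> proper_coloring T f \<and> (\<forall>e \<in> edges T. f e \<noteq> 0))"

fun branch_forks :: "branch \<Rightarrow> vertex set" where
  "branch_forks Leaf = {}"
| "branch_forks (Fork l r) =
     insert [] ((#) 0 ` branch_forks l \<union> (#) 1 ` branch_forks r)"

lemma edge_inject: "edge u = edge v \<longleftrightarrow> u = v" if "u \<noteq> []" "v \<noteq> []"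
proof
  assume "edge u = edge v"
  then consider "u = v" | "u = butlast v" "butlast u = v"
    unfolding edge_def doubleton_eq_iff by auto
  then show "u = v"
  proof cases
    case 2
    then have "length u = length v - 1" "length v = length u - 1"
      by (metis length_butlast)+
    moreover have "length u > 0" using that by simp
    ultimately show ?thesis by linarith
  qed
qed simp

lemma branch_forks_subset: "branch_forks b \<subseteq> branch_vertices b"
  by (induction b) auto

lemma Nil_in_branch_vertices: "[] \<in> branch_vertices b"
  by (cases b) auto

lemma snoc_in_branch_vertices:
  "q @ [i] \<in> branch_vertices b \<longleftrightarrow> q \<in> branch_forks b \<and> (i = 0 \<or> i = 1)"
proof (induction b arbitrary: q)
  case (Fork l r)
  show ?case
  proof (cases q)
    case Nil
    then show ?thesis by (auto simp: image_iff Nil_in_branch_vertices)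
  next
    case (Cons a p)
    then show ?thesis using Fork by (auto simp: image_iff)
  qed
qed auto

lemma mem_edge_iff:
  "v \<in> edge u \<longleftrightarrow> u = v \<or> (\<exists>i. u = v @ [i])" if "u \<noteq> []"
  using that unfolding edge_def
  by (metis append_butlast_last_id butlast_snoc insert_iff singletonD)

lemma incident_root: "incident (Root b) [] = {edge [0]}"
  by (auto simp: incident_def edges_def mem_edge_iff Nil_in_branch_vertices)

lemma incident_Cons:
  assumes "q \<in> branch_vertices b"
  shows "incident (Root b) (0 # q) =
    (if q \<in> branch_forks b then {edge (0 # q), edge (0 # q @ [0]), edge (0 # q @ [1])}
     else {edge (0 # q)})"
proof -
  have "incident (Root b) (0 # q) =
      edge ` {u \<in> vertices (Root b) - {[]}. u = 0 # q \<or> (\<exists>i. u = 0 # q @ [i])}"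
    unfolding incident_def edges_def by (auto simp: mem_edge_iff)
  also have "{u \<in> vertices (Root b) - {[]}. u = 0 # q \<or> (\<exists>i. u = 0 # q @ [i])} =
      insert (0 # q) {0 # q @ [i] | i. q @ [i] \<in> branch_vertices b}"
    using assms by auto
  also have "\<dots> = (if q \<in> branch_forks b then {0 # q, 0 # q @ [0], 0 # q @ [1]} else {0 # q})"
    by (auto simp: snoc_in_branch_vertices)
  finally show ?thesis by auto
qed

lemma determined_coloring_iff:
  assumes "length c = length (branch_leaves b)"
  shows "determined_coloring (Root b) c f \<longleftrightarrow>
    map (\<lambda>q. f (edge (0 # q))) (branch_leaves b) = c \<and>
    (\<forall>q \<in> branch_forks b.
       f (edge (0 # q)) + f (edge (0 # q @ [0])) + f (edge (0 # q @ [1])) = 0)"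
proof -
  have "(degree (Root b) (0 # q) = 3 \<longrightarrow> (\<Sum>e \<in> incident (Root b) (0 # q). f e) = 0) \<longleftrightarrow>
      (q \<in> branch_forks b \<longrightarrow>
       f (edge (0 # q)) + f (edge (0 # q @ [0])) + f (edge (0 # q @ [1])) = 0)"
    if "q \<in> branch_vertices b" for q
    using that by (simp add: degree_def incident_Cons edge_inject add.assoc)
  moreover have "degree (Root b) [] \<noteq> 3"
    by (simp add: degree_def incident_root)
  ultimately have "(\<forall>v \<in> vertices (Root b). degree (Root b) v = 3 \<longrightarrow>
        (\<Sum>e \<in> incident (Root b) v. f e) = 0) \<longleftrightarrow>
      (\<forall>q \<in> branch_forks b.
       f (edge (0 # q)) + f (edge (0 # q @ [0])) + f (edge (0 # q @ [1])) = 0)"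
    using branch_forks_subset[of b] by auto
  moreover have "(\<forall>i < length (leaves (Root b)). f (edge (leaves (Root b) ! i)) = c ! i) \<longleftrightarrow>
      map (\<lambda>q. f (edge (0 # q))) (branch_leaves b) = c"
    using assms by (simp add: list_eq_iff_nth_eq[of _ c])
  ultimately show ?thesis
    unfolding determined_coloring_def by (simp only:)
qed

lemma color_add_self: "x + x = 0" for x :: color
  by (cases x) (simp add: zero_prod_def)

lemma color_eq_of_sum: "x = y + z" if "x + y + z = 0" for x y z :: color
proof -
  have "x = x + ((y + z) + (y + z))" by (simp only: color_add_self add_0_right)
  also have "\<dots> = (x + y + z) + (y + z)" by (simp only: add.assoc)
  finally show ?thesis by (simp only: that add_0)
qed

lemma branch_coloring_unique:
  fixes g g' :: "vertex \<Rightarrow> color"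
  assumes "map g (branch_leaves b) = map g' (branch_leaves b)"
    and "\<forall>q \<in> branch_forks b. g q + g (q @ [0]) + g (q @ [1]) = 0"
    and "\<forall>q \<in> branch_forks b. g' q + g' (q @ [0]) + g' (q @ [1]) = 0"
    and "q \<in> branch_vertices b"
  shows "g q = g' q"
  using assms
proof (induction b arbitrary: g g' q)
  case (Fork l r)
  have L: "g (0 # p) = g' (0 # p)" if "p \<in> branch_vertices l" for p
    using Fork.IH(1)[of "\<lambda>p. g (0 # p)" "\<lambda>p. g' (0 # p)" p] Fork.prems(1-3) that by (auto simp: ball_Un)
  have R: "g (1 # p) = g' (1 # p)" if "p \<in> branch_vertices r" for p
    using Fork.IH(2)[of "\<lambda>p. g (1 # p)" "\<lambda>p. g' (1 # p)" p] Fork.prems(1-3) that by (auto simp: ball_Un)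
  have "g [] = g [0] + g [1]" "g' [] = g' [0] + g' [1]"
    using Fork.prems(2,3) by (auto intro: color_eq_of_sum)
  then have "g [] = g' []"
    using L R Nil_in_branch_vertices by simp
  then show ?case using L R Fork.prems(4) by auto
qed simp

lemma branch_coloring_exists:
  assumes "length c = length (branch_leaves b)"
  shows "\<exists>g :: vertex \<Rightarrow> color. map g (branch_leaves b) = c \<and>
    (\<forall>q \<in> branch_forks b. g q + g (q @ [0]) + g (q @ [1]) = 0)"
  using assms
proof (induction b arbitrary: c)
  case Leaf
  then show ?case by (intro exI[of _ "\<lambda>_. hd c"]) (cases c, auto)
next
  case (Fork l r)
  let ?n = "length (branch_leaves l)"
  obtain g where g: "map g (branch_leaves l) = take ?n c"
    "\<forall>q \<in> branch_forks l. g q + g (q @ [0]) + g (q @ [1]) = 0"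
    using Fork.IH(1)[of "take ?n c"] Fork.prems by auto
  obtain h where h: "map h (branch_leaves r) = drop ?n c"
    "\<forall>q \<in> branch_forks r. h q + h (q @ [0]) + h (q @ [1]) = 0"
    using Fork.IH(2)[of "drop ?n c"] Fork.prems by auto
  define k where "k q = (case q of [] \<Rightarrow> g [] + h [] | i # p \<Rightarrow> if i = 0 then g p else h p)" for q
  have "k [] + k [0] + k [1] = (g [] + g []) + (h [] + h [])"
    by (simp add: k_def ac_simps)
  then have "k [] + k [0] + k [1] = 0"
    by (simp only: color_add_self add_0)
  then have "\<forall>q \<in> branch_forks (Fork l r). k q + k (q @ [0]) + k (q @ [1]) = 0"
    using g(2) h(2) by (auto simp: k_def)
  moreover have "map k (branch_leaves (Fork l r)) = c"
    using g(1) h(1) by (simp add: k_def o_def)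
  ultimately show ?case by blast
qed

theorem coloring_exists:
  assumes "length c = length (leaves T)"
  shows "\<exists>f. determined_coloring T c f"
proof (cases T)
  case (Root b)
  with assms have len: "length c = length (branch_leaves b)" by simp
  obtain g where g: "map g (branch_leaves b) = c"
    "\<forall>q \<in> branch_forks b. g q + g (q @ [0]) + g (q @ [1]) = 0"
    using branch_coloring_exists[OF len] by blast
  define f where "f e = g (THE q. e = edge (0 # q))" for e
  have "f (edge (0 # q)) = g q" for q
    by (simp add: f_def edge_inject)
  then have "determined_coloring T c f"
    using g by (simp add: Root determined_coloring_iff[OF len])
  then show ?thesis by blast
qed

theorem coloring_unique:
  assumes "length c = length (leaves T)"
    and "determined_coloring T c f" "determined_coloring T c f'"
    and "e \<in> edges T"
  shows "f e = f' e"
proof (cases T)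
  case (Root b)
  with assms(1) have len: "length c = length (branch_leaves b)" by simp
  obtain q where q: "q \<in> branch_vertices b" "e = edge (0 # q)"
    using assms(4) by (auto simp: Root edges_def)
  have "map (\<lambda>q. f (edge (0 # q))) (branch_leaves b) = map (\<lambda>q. f' (edge (0 # q))) (branch_leaves b)"
    using assms(2,3) by (simp only: Root determined_coloring_iff[OF len])
  then show ?thesis
    using branch_coloring_unique[of "\<lambda>q. f (edge (0 # q))" b "\<lambda>q. f' (edge (0 # q))" q]
      assms(2,3) q by (simp only: Root determined_coloring_iff[OF len] append_Cons simp_thms) blast
qed

end

theory Submission
  imports Defs
begin

text \<open>
  At a vertex of degree 3 the upper edge carries the sum of the two lower ones. So the coloring
  determined by \<open>w\<close> is proper with non-zero colors exactly when every block of \<open>w\<close>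
  that lies below an edge has non-zero sum (\<open>bracketing_valid\<close>), and the theorem is about
  bracketings of \<open>w\<close> all of whose blocks have non-zero sum. The parity conditions enter only
  through one consequence: the sum of the whole word is non-zero (\<open>sum_list_parity\<close>).

  A bracketing is found by contracting letters. If two distinct neighbours \<open>a\<close>, \<open>b\<close> of
  \<open>w\<close> are replaced by \<open>a + b\<close>, the sum of the word does not change, and a bracketing of
  the shorter word yields one of \<open>w\<close> by splitting a leaf (\<open>bracketing_split\<close>). The
  induction can only get stuck at a constant word of length at least two. If contracting
  \<open>a b\<close> gives the constant word in the letter \<open>c\<close>, then \<open>w\<close> is
  \<open>c \<dots> c a b c \<dots> c\<close>; its length is even because its sum is not 0, so unless
  \<open>w = a b\<close> there are at least two letters \<open>c\<close>. Contracting a \<open>c\<close> with the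
  neighbouring \<open>a\<close> or \<open>b\<close> instead leaves a non-constant word
  (\<open>contraction_nonconstant\<close>).
\<close>

lemma color_add_eq_0_iff: "a + b = 0 \<longleftrightarrow> a = b" for a b :: color
proof
  show "a = b" if "a + b = 0"
    using color_eq_of_sum[of a b 0] that by simp
qed (simp only: color_add_self)

lemma color_add_cancel: "a + (a + b) = b" "(a + b) + b = a" for a b :: color
proof -
  show "a + (a + b) = b"
    by (simp only: add.assoc[symmetric] color_add_self add_0)
  show "(a + b) + b = a"
    by (simp only: add.assoc color_add_self add_0_right)
qed

text \<open>\<open>bracketing w s\<close> means that the edges of some branch with leaf colors \<open>w\<close> get
  non-zero colors and that its topmost edge gets the color \<open>s\<close>.\<close>

inductive bracketing :: "color list \<Rightarrow> color \<Rightarrow> bool" where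
  leaf: "a \<noteq> 0 \<Longrightarrow> bracketing [a] a"
| fork: "bracketing u a \<Longrightarrow> bracketing v b \<Longrightarrow> a \<noteq> b \<Longrightarrow> bracketing (u @ v) (a + b)"

lemma bracketing_split:
  assumes "bracketing (u @ (a + b) # v) s" and "a \<noteq> 0" "b \<noteq> 0" "a \<noteq> b"
  shows "bracketing (u @ a # b # v) s"
  using assms(1)
proof (induction "u @ (a + b) # v" s arbitrary: u v rule: bracketing.induct)
  case (leaf c)
  then have "u = []" "v = []" "c = a + b"
    by (auto simp: Cons_eq_append_conv)
  moreover have "bracketing ([a] @ [b]) (a + b)"
    using assms by (intro bracketing.intros)
  ultimately show ?case by simp
next
  case (fork u1 s1 u2 s2)
  from fork.hyps(6) consider
      (left) t where "u1 = u @ (a + b) # t" "v = t @ u2"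
    | (right) t where "u = u1 @ t" "u2 = t @ (a + b) # v"
    by (auto simp: append_eq_append_conv2 append_eq_Cons_conv Cons_eq_append_conv)
  then show ?case
  proof cases
    case left
    from bracketing.fork[OF fork.hyps(2)[OF left(1)] fork.hyps(3) fork.hyps(5)]
    show ?thesis by (simp add: left)
  next
    case right
    from bracketing.fork[OF fork.hyps(1) fork.hyps(4)[OF right(2)] fork.hyps(5)]
    show ?thesis by (simp add: right)
  qed
qed

lemma bracketing_branch_coloring:
  assumes "bracketing w s"
  shows "\<exists>b g. map g (branch_leaves b) = w \<and> g [] = s \<and>
    (\<forall>q \<in> branch_forks b. g q + g (q @ [0]) + g (q @ [1]) = 0) \<and>
    (\<forall>q \<in> branch_vertices b. g q \<noteq> 0)"
  using assms
proof induction
  case (leaf a)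
  then show ?case by (intro exI[of _ Leaf] exI[of _ "\<lambda>_. a"]) simp
next
  case (fork u s v t)
  obtain l g where g: "map g (branch_leaves l) = u" "g [] = s"
    "\<forall>q \<in> branch_forks l. g q + g (q @ [0]) + g (q @ [1]) = 0"
    "\<forall>q \<in> branch_vertices l. g q \<noteq> 0"
    using fork.IH(1) by blast
  obtain r h where h: "map h (branch_leaves r) = v" "h [] = t"
    "\<forall>q \<in> branch_forks r. h q + h (q @ [0]) + h (q @ [1]) = 0"
    "\<forall>q \<in> branch_vertices r. h q \<noteq> 0"
    using fork.IH(2) by blast
  define k where
    "k q = (case q of [] \<Rightarrow> s + t | i # p \<Rightarrow> if i = 0 then g p else h p)" for q :: vertex
  have "k [] + k [0] + k [1] = (s + t) + (s + t)"
    by (simp add: k_def g(2) h(2) add.assoc)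
  then have "k [] + k [0] + k [1] = 0"
    by (simp only: color_add_self)
  then have "\<forall>q \<in> branch_forks (Fork l r). k q + k (q @ [0]) + k (q @ [1]) = 0"
    using g(3) h(3) by (auto simp: k_def)
  moreover have "\<forall>q \<in> branch_vertices (Fork l r). k q \<noteq> 0"
    using g(4) h(4) \<open>s \<noteq> t\<close> by (auto simp: k_def color_add_eq_0_iff)
  moreover have "map k (branch_leaves (Fork l r)) = u @ v"
    using g(1) h(1) by (simp add: k_def o_def)
  moreover have "k [] = s + t"
    by (simp add: k_def)
  ultimately show ?case by blast
qed

text \<open>Three non-zero colors with sum 0 are pairwise distinct, and two edges with a common vertex
  meet at a vertex of degree 3. Hence non-zero colors already make the coloring proper.\<close>

lemma bracketing_valid:
  assumes "bracketing w s"
  shows "\<exists>T. valid w T"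
proof -
  obtain b g where g: "map g (branch_leaves b) = w"
    and forks: "\<And>q. q \<in> branch_forks b \<Longrightarrow> g q + g (q @ [0]) + g (q @ [1]) = 0"
    and nz: "\<And>q. q \<in> branch_vertices b \<Longrightarrow> g q \<noteq> 0"
    using bracketing_branch_coloring[OF assms] by blast
  define f where "f e = g (THE q. e = edge (0 # q))" for e
  have f: "f (edge (0 # q)) = g q" for q
    by (simp add: f_def edge_inject)
  have len: "length w = length (branch_leaves b)"
    using g by auto
  have "determined_coloring (Root b) w f"
    using g forks by (simp add: determined_coloring_iff[OF len] f)
  moreover have edges: "\<exists>q \<in> branch_vertices b. e = edge (0 # q)" if "e \<in> edges (Root b)" for e
    using that by (auto simp: edges_def)
  moreover have parent: "g q \<noteq> g (q @ [i])" if "q @ [i] \<in> branch_vertices b" for q i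
  proof
    assume eq: "g q = g (q @ [i])"
    have q: "q \<in> branch_forks b" and i: "i = 0 \<or> i = 1"
      using that by (auto simp: snoc_in_branch_vertices)
    have child: "g (q @ [0]) \<noteq> 0" "g (q @ [1]) \<noteq> 0"
      using q nz by (auto simp: snoc_in_branch_vertices)
    have "g q = g (q @ [0]) + g (q @ [1])"
      using color_eq_of_sum[OF forks[OF q]] .
    with eq i child show False by auto
  qed
  moreover have siblings: "g (q @ [i]) \<noteq> g (q @ [j])"
    if "q @ [i] \<in> branch_vertices b" "q @ [j] \<in> branch_vertices b" "i \<noteq> j" for q i j
  proof
    assume eq: "g (q @ [i]) = g (q @ [j])"
    have q: "q \<in> branch_forks b" and ij: "i = 0 \<and> j = 1 \<or> i = 1 \<and> j = 0"
      using that by (auto simp: snoc_in_branch_vertices)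
    have "g q = g (q @ [0]) + g (q @ [1])"
      using color_eq_of_sum[OF forks[OF q]] .
    also have "\<dots> = 0"
      using eq ij by (auto simp: color_add_eq_0_iff)
    finally show False
      using nz q branch_forks_subset by blast
  qed
  have "g p \<noteq> g q" if pq: "p \<in> branch_vertices b" "q \<in> branch_vertices b" "p \<noteq> q"
    and meet: "edge (0 # p) \<inter> edge (0 # q) \<noteq> {}" for p q
  proof -
    obtain v where v: "v \<in> edge (0 # p)" "v \<in> edge (0 # q)"
      using meet by auto
    have "0 # p = v \<or> (\<exists>i. 0 # p = v @ [i])" "0 # q = v \<or> (\<exists>i. 0 # q = v @ [i])"
      using v by (simp_all add: mem_edge_iff)
    then have "(\<exists>i. q = p @ [i]) \<or> (\<exists>i. p = q @ [i]) \<or> (\<exists>t i j. p = t @ [i] \<and> q = t @ [j])"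
      using \<open>p \<noteq> q\<close> by (cases v) auto
    then consider i where "q = p @ [i]" | i where "p = q @ [i]"
      | t i j where "p = t @ [i]" "q = t @ [j]"
      by blast
    then show ?thesis
      using pq parent siblings by cases metis+
  qed
  then have "proper_coloring (Root b) f"
    unfolding proper_coloring_def using edges f by metis
  moreover have "\<forall>e \<in> edges (Root b). f e \<noteq> 0"
    using edges f nz by metis
  ultimately have "valid w (Root b)"
    using len by (auto simp: valid_def)
  then show ?thesis ..
qed

lemma sum_list_constant_color:
  fixes w :: "color list"
  assumes "set w \<subseteq> {c}" and "even (length w)"
  shows "sum_list w = 0"
  using assms
proof (induction w rule: induct_list012)
  case (3 a b w)
  then have "sum_list (a # b # w) = c + (c + 0)" by simp
  then show ?case by (simp add: color_add_self)
qed auto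

lemma nonconstant_adjacent_distinct:
  assumes "\<not> (\<exists>a. set w \<subseteq> {a})"
  shows "\<exists>u a b v. w = u @ a # b # v \<and> a \<noteq> b"
  using assms
proof (induction w)
  case (Cons a w)
  show ?case
  proof (cases "\<exists>b. set w \<subseteq> {b}")
    case True
    then obtain b where b: "set w \<subseteq> {b}" by blast
    with Cons.prems obtain c v where "w = c # v" "a \<noteq> c"
      by (cases w) auto
    then have "a # w = [] @ a # c # v \<and> a \<noteq> c" by simp
    then show ?thesis by blast
  next
    case False
    then obtain u c d v where "w = u @ c # d # v" "c \<noteq> d"
      using Cons.IH by blast
    then have "a # w = (a # u) @ c # d # v \<and> c \<noteq> d" by simp
    then show ?thesis by blast
  qed
qed simp

lemma contraction_nonconstant:
  fixes w :: "color list"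
  assumes "\<not> (\<exists>a. set w \<subseteq> {a})" and "0 \<notin> set w" and "sum_list w \<noteq> 0" and "length w \<noteq> 2"
  shows "\<exists>u a b v. w = u @ a # b # v \<and> a \<noteq> b \<and> \<not> (\<exists>c. set (u @ (a + b) # v) \<subseteq> {c})"
proof -
  obtain u a b v where w: "w = u @ a # b # v" "a \<noteq> b"
    using nonconstant_adjacent_distinct[OF assms(1)] by blast
  show ?thesis
  proof (cases "\<exists>c. set (u @ (a + b) # v) \<subseteq> {c}")
    case False
    with w show ?thesis by blast
  next
    case True
    then have const: "set (u @ (a + b) # v) \<subseteq> {a + b}" by auto
    have nz: "a \<noteq> 0" "b \<noteq> 0"
      using assms(2) w by auto
    have "sum_list (u @ (a + b) # v) \<noteq> 0"
      using assms(3) by (simp add: w add.assoc)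
    then have "odd (length (u @ (a + b) # v))"
      using sum_list_constant_color[OF const] by blast
    then have "even (length u + length v)" by simp
    moreover have "length u + length v \<noteq> 0"
      using assms(4) by (simp add: w)
    ultimately have len: "length u + length v \<ge> 2" by presburger
    show ?thesis
    proof (cases v)
      case (Cons c v')
      then have c: "c = a + b" using const by simp
      \<comment> \<open>Contract \<open>b c\<close> to \<open>a\<close>; a letter \<open>c\<close> remains besides \<open>a a\<close>.\<close>
      have "set u \<union> set v' \<noteq> {}"
        using len Cons by auto
      moreover have "set u \<union> set v' \<subseteq> {a + b}"
        using const Cons by auto
      ultimately have "a + b \<in> set u \<union> set v'" by (metis subset_singletonD insertI1)
      moreover have "a + b \<noteq> a"
        using nz by simp
      ultimately have "\<not> (\<exists>d. set ((u @ [a]) @ (b + c) # v') \<subseteq> {d})"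
        by auto
      moreover have "w = (u @ [a]) @ b # c # v'" "b \<noteq> c"
        using w Cons c nz by auto
      ultimately show ?thesis by blast
    next
      case Nil
      then obtain u' c where u: "u = u' @ [c]"
        using len by (cases u rule: rev_cases) auto
      then have c: "c = a + b" using const by simp
      have "set u' \<noteq> {}"
        using len Nil u by auto
      moreover have "set u' \<subseteq> {a + b}"
        using const u by auto
      ultimately have "a + b \<in> set u'" by (metis subset_singletonD insertI1)
      moreover have "a + b \<noteq> b"
        using nz by simp
      ultimately have "\<not> (\<exists>d. set (u' @ (c + a) # [b]) \<subseteq> {d})"
        by auto
      moreover have "w = u' @ c # a # [b]" "c \<noteq> a"
        using w Nil u c nz by auto
      ultimately show ?thesis by blast
    qed
  qed
qed

lemma nonconstant_bracketing:
  fixes w :: "color list"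
  assumes "\<not> (\<exists>a. set w \<subseteq> {a})" and "0 \<notin> set w" and "sum_list w \<noteq> 0"
  shows "bracketing w (sum_list w)"
  using assms
proof (induction "length w" arbitrary: w rule: less_induct)
  case less
  show ?case
  proof (cases "length w = 2")
    case True
    then obtain a b where w: "w = [a, b]"
      by (auto simp: length_Suc_conv numeral_2_eq_2)
    have "bracketing ([a] @ [b]) (a + b)"
      using less.prems w by (intro bracketing.intros) auto
    with w show ?thesis by simp
  next
    case False
    then obtain u a b v where w: "w = u @ a # b # v" and ab: "a \<noteq> b"
      and nonconst: "\<not> (\<exists>c. set (u @ (a + b) # v) \<subseteq> {c})"
      using contraction_nonconstant less.prems by blast
    let ?w' = "u @ (a + b) # v"
    have sum: "sum_list ?w' = sum_list w"
      by (simp add: w add.assoc)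
    have "0 \<notin> set ?w'"
      using less.prems(2) w ab color_add_eq_0_iff[of a b] by auto
    moreover have "length ?w' < length w"
      by (simp add: w)
    moreover have "sum_list ?w' \<noteq> 0"
      using less.prems(3) sum by (simp only: simp_thms)
    ultimately have "bracketing ?w' (sum_list ?w')"
      using less.hyps nonconst by blast
    then have "bracketing ?w' (sum_list w)"
      by (simp only: sum)
    from bracketing_split[OF this] show ?thesis
      using less.prems(2) ab w by auto
  qed
qed

lemma sum_list_parity:
  fixes w :: "color list"
  assumes "distinct [x, y, z]" and "set w \<subseteq> {x, y, z}"
  shows "sum_list w = (if odd (count_list w x) then x else 0) +
    (if odd (count_list w y) then y else 0) + (if odd (count_list w z) then z else 0)"
  using assms(2)
proof (induction w)
  case (Cons a w)
  then consider "a = x" | "a = y" | "a = z" by auto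
  then show ?case
    using Cons assms(1)
    by cases (auto simp: color_add_cancel color_add_self ac_simps)
qed simp

theorem lemma12p7:
  fixes x y z :: color and w :: "color list"
  assumes "distinct [x, y, z]" and "{x, y, z} = UNIV - {0}"
    and "set w \<subseteq> {x, y, z}"
    and "\<not> (\<exists>a. set w \<subseteq> {a})"
    and "[count_list w x = count_list w y] (mod 2)"
    and "\<not> [count_list w y = count_list w z] (mod 2)"
    and "[count_list w z = length w] (mod 2)"
  shows "\<exists>T. valid w T"
proof -
  have "0 \<notin> set w"
    using assms(2,3) by blast
  moreover have "odd (count_list w x) \<longleftrightarrow> odd (count_list w y)"
    "odd (count_list w y) \<longleftrightarrow> even (count_list w z)"
    using assms(5,6) unfolding cong_def by presburger+
  \<comment> \<open>The sum is \<open>x + y\<close> or \<open>z\<close>.\<close>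
  then have "sum_list w \<noteq> 0"
    using assms(1,2) sum_list_parity[OF assms(1,3)] color_add_eq_0_iff[of x y] by auto
  ultimately have "bracketing w (sum_list w)"
    using nonconstant_bracketing assms(4) by blast
  then show ?thesis by (rule bracketing_valid)
qed

end
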